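(* Let $C_m$ be the cycle with $m\ge3$ edges. Then \[ \mathrm{vol}(\mathscr{Q}(C_m))=\frac{\mathrm{vol}(\mathscr{O}(C_m))}{2^m}=\frac{m\,A_{2m-1}}{2^m(2m)!}, \] volumes being taken in $\mathbb{R}^{2m}$.
   Context: $C_m$ has vertices $1,\dots,m$ and edges $(1,2),(2,3),\dots,(m-1,m),(m,1)$. For a graph $G=(V,E)$, polytopes live in $\mathbb{R}^{|V|+|E|}$ with coordinates $x_i$ ($i\in V$), $y_{ij}$ ($(i,j)\in E$). $\mathscr{Q}(G)$: points with all coordinates in $[0,1]$ satisfying for each edge $(i,j)$: $y_{ij}\ge0$, $y_{ij}\le x_i$, $y_{ij}\le x_j$, $x_i+x_j\le1+y_{ij}$. $\mathscr{O}(G)$: points with all coordinates in $[0,1]$ satisfying $y_{ij}\le x_i$, $y_{ij}\le x_j$ for each edge. The Euler number $A_k$ ($k\ge1$) is the number of permutations $w$ of $\{1,\dots,k\}$ with $w_1>w_2<w_3>\cdots$; $A_0:=1$. *)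

theory Defs
  imports "HOL-Analysis.Analysis" "HOL-Combinatorics.Permutations"
begin

(* A simple graph is a pair of its vertex set and its set of edges; an undirected
   edge (i,j) is the two-element set {i,j}. *)
type_synonym 'a graph = "'a set \<times> 'a set set"

definition cycle_graph :: "nat \<Rightarrow> nat graph" where
  "cycle_graph m = ({1..m}, {{i, i + 1} | i. i \<in> {1..<m}} \<union> {{m, 1}})"

(* The coordinates of the space of dimension |V| + |E| are indexed by the disjoint sum
   of V and E: x_i is p (Inl i), and y_ij is p (Inr {i,j}).  Points are functions that
   are undefined off this index set, as in the carrier of the product measure. *)
definition coords :: "'a graph \<Rightarrow> ('a + 'a set) set" where
  "coords G = fst G <+> snd G"

definition Q_polytope :: "'a graph \<Rightarrow> ('a + 'a set \<Rightarrow> real) set" where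
  "Q_polytope G = {p \<in> coords G \<rightarrow>\<^sub>E {0..1}. \<forall>i j. {i, j} \<in> snd G \<longrightarrow>
     0 \<le> p (Inr {i, j}) \<and>
     p (Inr {i, j}) \<le> p (Inl i) \<and>
     p (Inr {i, j}) \<le> p (Inl j) \<and>
     p (Inl i) + p (Inl j) \<le> 1 + p (Inr {i, j})}"

definition O_polytope :: "'a graph \<Rightarrow> ('a + 'a set \<Rightarrow> real) set" where
  "O_polytope G = {p \<in> coords G \<rightarrow>\<^sub>E {0..1}. \<forall>i j. {i, j} \<in> snd G \<longrightarrow>
     p (Inr {i, j}) \<le> p (Inl i) \<and>
     p (Inr {i, j}) \<le> p (Inl j)}"

definition graph_vol :: "'a graph \<Rightarrow> ('a + 'a set \<Rightarrow> real) set \<Rightarrow> real" where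
  "graph_vol G S = measure (\<Pi>\<^sub>M c\<in>coords G. lborel) S"

(* Permutations with w 1 > w 2 < w 3 > ...; for k = 0 the convention that the value
   is 1 holds automatically, see euler_number_0. *)
definition euler_number :: "nat \<Rightarrow> nat" where
  "euler_number k = card {w. w permutes {1..k} \<and>
     (\<forall>i\<in>{1..<k}. if odd i then w i > w (i + 1) else w i < w (i + 1))}"

lemma euler_number_0: "euler_number 0 = 1"
  by (simp add: euler_number_def)

lemma card_coords_cycle_graph:
  assumes "m \<ge> 3"
  shows "card (coords (cycle_graph m)) = 2 * m"
proof -
  let ?P = "(\<lambda>i::nat. {i, i + 1}) ` {1..<m}"
  have "inj_on (\<lambda>i::nat. {i, i + 1}) {1..<m}"
    by (auto simp: inj_on_def doubleton_eq_iff)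
  then have "card ?P = m - 1"
    by (simp add: card_image)
  moreover have "{m, 1} \<notin> ?P"
    using assms by (auto simp: doubleton_eq_iff)
  moreover have "snd (cycle_graph m) = insert {m, 1} ?P"
    by (auto simp: cycle_graph_def)
  ultimately have "card (snd (cycle_graph m)) = m" "finite (snd (cycle_graph m))"
    using assms by simp_all
  moreover have "card (fst (cycle_graph m)) = m" "finite (fst (cycle_graph m))"
    by (simp_all add: cycle_graph_def)
  ultimately show ?thesis
    by (simp add: coords_def card_Plus)
qed

end

theory Submission
  imports Defs "HOL-Probability.Probability"
begin

text \<open>
  Volumes in the cube are probabilities for independent uniform coordinates.
  For fixed vertex coordinates, the edge coordinates of a point of \<open>Q\<close> or \<open>O\<close> range over a box,
  with side \<open>min s t\<close> for \<open>O\<close> and \<open>min s t - max 0 (s + t - 1) = min (tent s) (tent t) / 2\<close> for \<open>Q\<close>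
  at an edge with endpoint coordinates \<open>s\<close> and \<open>t\<close>. As the tent map preserves the uniform distribution,
  \<open>vol Q = vol O / 2\<^sup>m\<close>. On the other hand \<open>O\<close> is the order polytope of the cyclic zigzag
  on \<open>2 m\<close> elements, so its volume is the number of linear extensions divided by \<open>(2 m)!\<close>.
  The maximum of a linear extension sits at one of the \<open>m\<close> vertices, which are equivalent under rotation;
  deleting it leaves an alternating permutation of \<open>2 m - 1\<close> elements.
\<close>

declare One_nat_def [simp del]

subsection \<open>Uniform random points in the cube\<close>

text \<open>The measure lives on the whole line, not on the unit interval, so measurability is plain
  Borel measurability and membership in the cube holds almost everywhere.\<close>

definition unif :: "real measure" where
  "unif = uniform_measure lborel {0..1}"

abbreviation unifs :: "'i set \<Rightarrow> ('i \<Rightarrow> real) measure" where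
  "unifs I \<equiv> \<Pi>\<^sub>M i\<in>I. unif"

lemma space_unif [simp]: "space unif = UNIV"
  and sets_unif [simp, measurable_cong]: "sets unif = sets borel"
  by (simp_all add: unif_def)

lemma emeasure_unif: "A \<in> sets borel \<Longrightarrow> emeasure unif A = emeasure lborel ({0..1} \<inter> A)"
  by (simp add: unif_def divide_ennreal_def)

interpretation unif: prob_space unif
  unfolding unif_def by (intro prob_space_uniform_measure) auto

interpretation unifs: product_prob_space "\<lambda>_. unif" I for I
  by unfold_locales

text \<open>A product measure is determined by its values on boxes. The intersection of a box with
  the cube is again a box, so its Lebesgue measure factors over the coordinates.\<close>

lemma unifs_eq_uniform_measure:
  assumes "finite I"
  shows "unifs I = uniform_measure (\<Pi>\<^sub>M i\<in>I. lborel) (I \<rightarrow>\<^sub>E {0..1})"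
proof -
  interpret lborels: product_sigma_finite "\<lambda>_::'a. lborel :: real measure"
    by unfold_locales
  have cube: "I \<rightarrow>\<^sub>E {0..1::real} \<in> sets (\<Pi>\<^sub>M i\<in>I. lborel)"
    by (intro sets_PiM_I_finite assms) auto
  have "uniform_measure (\<Pi>\<^sub>M i\<in>I. lborel) (I \<rightarrow>\<^sub>E {0..1}) = unifs I"
  proof (rule unifs.PiM_eqI[OF assms])
    show "sets (uniform_measure (\<Pi>\<^sub>M i\<in>I. lborel) (I \<rightarrow>\<^sub>E {0..1})) = sets (unifs I)"
      by (simp cong: sets_PiM_cong)
  next
    fix A :: "'a \<Rightarrow> real set"
    assume A: "\<And>i. i \<in> I \<Longrightarrow> A i \<in> sets unif"
    then have "Pi\<^sub>E I A \<in> sets (\<Pi>\<^sub>M i\<in>I. lborel)"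
      by (intro sets_PiM_I_finite assms) auto
    with cube A show "emeasure (uniform_measure (\<Pi>\<^sub>M i\<in>I. lborel) (I \<rightarrow>\<^sub>E {0..1})) (Pi\<^sub>E I A) =
        (\<Prod>i\<in>I. emeasure unif (A i))"
      by (simp add: PiE_Int lborels.emeasure_PiM assms emeasure_unif divide_ennreal_def)
  qed
  then show ?thesis ..
qed

text \<open>The cube has Lebesgue volume 1, so no normalising factor appears. This is the passage
  from volumes to probabilities.\<close>

lemma measure_lborel_cube_Int:
  assumes "finite I" "B \<in> sets (unifs I)"
  shows "measure (\<Pi>\<^sub>M i\<in>I. lborel) ((I \<rightarrow>\<^sub>E {0..1}) \<inter> B) = measure (unifs I) B"
proof -
  interpret lborels: product_sigma_finite "\<lambda>_::'a. lborel :: real measure"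
    by unfold_locales
  have "B \<in> sets (\<Pi>\<^sub>M i\<in>I. lborel)"
    using assms(2) by (simp cong: sets_PiM_cong)
  moreover have "I \<rightarrow>\<^sub>E {0..1::real} \<in> sets (\<Pi>\<^sub>M i\<in>I. lborel)"
    by (intro sets_PiM_I_finite assms) auto
  ultimately show ?thesis
    by (simp add: unifs_eq_uniform_measure assms measure_def lborels.emeasure_PiM divide_ennreal_def)
qed

lemma AE_unifs_cube:
  assumes "finite I"
  shows "AE p in unifs I. p \<in> I \<rightarrow>\<^sub>E {0..1}"
  unfolding unifs_eq_uniform_measure[OF assms]
  by (intro AE_uniform_measureI sets_PiM_I_finite assms) auto

text \<open>By Fubini with coordinate \<open>i\<close> innermost: once the other coordinates are
  fixed, \<open>p i\<close> has to hit the single point \<open>p j\<close>, which has measure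
  0.\<close>

lemma AE_unifs_neq:
  assumes "finite I" "i \<in> I" "j \<in> I" "i \<noteq> j"
  shows "AE p in unifs I. p i \<noteq> p j"
proof -
  define J where "J = I - {i}"
  have I: "I = insert i J" and J: "finite J" "i \<notin> J" "j \<in> J"
    using assms by (auto simp: J_def)
  have [measurable]: "(\<lambda>p. p i) \<in> borel_measurable (unifs I)" "(\<lambda>p. p j) \<in> borel_measurable (unifs I)"
    using measurable_component_singleton[of i I "\<lambda>_. unif"]
      measurable_component_singleton[of j I "\<lambda>_. unif"] assms
    by (simp_all cong: measurable_cong_sets)
  let ?A = "{p \<in> space (unifs I). p i = p j}"
  have A: "?A \<in> sets (unifs I)"
    by measurable
  have "emeasure (unifs I) ?A = (\<integral>\<^sup>+ p. indicator ?A p \<partial>unifs I)"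
    using A by simp
  also have "\<dots> = (\<integral>\<^sup>+ x. (\<integral>\<^sup>+ y. indicator ?A (x(i := y)) \<partial>unif) \<partial>unifs J)"
    unfolding I
    by (rule unifs.product_nn_integral_insert) (use J A I in auto)
  also have "\<dots> = (\<integral>\<^sup>+ x. (\<integral>\<^sup>+ y. indicator {x j} y \<partial>unif) \<partial>unifs J)"
  proof (intro nn_integral_cong)
    fix x y assume "x \<in> space (unifs J)"
    then show "indicator ?A (x(i := y)) = (indicator {x j} y :: ennreal)"
      using J unfolding I by (auto simp: indicator_def space_PiM PiE_def extensional_def)
  qed
  also have "\<dots> = 0"
  proof -
    have "emeasure lborel ({0..1} \<inter> {c}) = 0" for c :: real
      by (rule emeasure_lborel_countable) auto
    then show ?thesis
      by (simp add: emeasure_unif)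
  qed
  finally have "emeasure (unifs I) ?A = 0" .
  then have "?A \<in> null_sets (unifs I)"
    using A by (rule null_setsI)
  then show ?thesis
    by (rule AE_I') simp
qed

subsection \<open>Volumes of order polytopes\<close>

text \<open>The permutation maps this set bijectively onto \<open>{1..w i}\<close>. Thus
  \<open>w\<close> can be recovered from the order of its values alone.\<close>

lemma permutes_rank:
  assumes "w permutes {1..n}" "i \<in> {1..n}"
  shows "card {j \<in> {1..n}. w j \<le> w i} = w i"
proof -
  have "w ` {j \<in> {1..n}. w j \<le> w i} = {1..w i}"
  proof
    have "w j \<in> {1..w i}" if "j \<in> {1..n}" "w j \<le> w i" for j
      using permutes_in_seg[OF assms(1) that(1)] that(2) by simp
    then show "w ` {j \<in> {1..n}. w j \<le> w i} \<subseteq> {1..w i}"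
      by blast
    show "{1..w i} \<subseteq> w ` {j \<in> {1..n}. w j \<le> w i}"
    proof
      fix k assume k: "k \<in> {1..w i}"
      then have "k \<in> {1..n}"
        using permutes_in_seg[OF assms] by auto
      then obtain j where "j \<in> {1..n}" "k = w j"
        using permutes_image[OF assms(1)] by blast
      then show "k \<in> w ` {j \<in> {1..n}. w j \<le> w i}"
        using k by auto
    qed
  qed
  moreover have "card (w ` {j \<in> {1..n}. w j \<le> w i}) = card {j \<in> {1..n}. w j \<le> w i}"
    by (intro card_image permutes_inj_on[OF assms(1)])
  ultimately show ?thesis
    by simp
qed

text \<open>Within the cube, the cells of the permutations are the simplices of its standard
  triangulation, without the walls between them. The strict inequalities make them disjoint; points
  with repeated coordinates lie in none of them.\<close>

definition order_cell :: "nat \<Rightarrow> (nat \<Rightarrow> nat) \<Rightarrow> (nat \<Rightarrow> real) set" where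
  "order_cell n w = {p \<in> space (unifs {1..n}). \<forall>i\<in>{1..n}. \<forall>j\<in>{1..n}. w i < w j \<longrightarrow> p i < p j}"

lemma measurable_unifs_component [measurable]:
  "i \<in> I \<Longrightarrow> (\<lambda>p. p i) \<in> borel_measurable (unifs I)"
  using measurable_component_singleton[of i I "\<lambda>_. unif"] by (simp cong: measurable_cong_sets)

lemma sets_order_cell [measurable]: "order_cell n w \<in> sets (unifs {1..n})"
  unfolding order_cell_def by measurable

text \<open>By trichotomy, with injectivity of \<open>w\<close> for ties. Consequently an inequality
  between two coordinates holds on all of a cell or nowhere on it.\<close>

lemma order_cell_le_iff:
  assumes "w permutes {1..n}" "p \<in> order_cell n w" "i \<in> {1..n}" "j \<in> {1..n}"
  shows "p i \<le> p j \<longleftrightarrow> w i \<le> w j"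
proof -
  have "p i < p j" if "w i < w j"
    using that assms by (auto simp: order_cell_def)
  moreover have "p j < p i" if "w j < w i"
    using that assms by (auto simp: order_cell_def)
  moreover have "i = j" if "w i = w j"
    using that permutes_inj[OF assms(1)] by (auto dest: injD)
  ultimately show ?thesis
    by (cases "w i" "w j" rule: linorder_cases) auto
qed

text \<open>A common point orders the indices in the same way for both permutations, so all ranks
  agree, and the ranks are the values.\<close>

lemma order_cell_disjoint:
  assumes "w permutes {1..n}" "w' permutes {1..n}" "p \<in> order_cell n w" "p \<in> order_cell n w'"
  shows "w = w'"
proof
  fix i
  show "w i = w' i"
  proof (cases "i \<in> {1..n}")
    case True
    have "{j \<in> {1..n}. w j \<le> w i} = {j \<in> {1..n}. w' j \<le> w' i}"
      using order_cell_le_iff[OF assms(1,3)] order_cell_le_iff[OF assms(2,4)] True by blast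
    then show ?thesis
      using permutes_rank[OF assms(1) True] permutes_rank[OF assms(2) True] by simp
  next
    case False
    then show ?thesis
      using assms(1,2) by (simp add: permutes_not_in)
  qed
qed

text \<open>The permutation sought is the rank function of \<open>p\<close>; distinctness of the
  coordinates makes it injective.\<close>

lemma ex_order_cell:
  assumes "p \<in> space (unifs {1..n})" "inj_on p {1..n}"
  obtains w where "w permutes {1..n}" "p \<in> order_cell n w"
proof -
  let ?I = "{1..n}"
  define r where "r i = {j \<in> ?I. p j \<le> p i}" for i
  define w where "w i = (if i \<in> ?I then card (r i) else i)" for i
  have mono: "w i < w j" if "i \<in> ?I" "j \<in> ?I" "p i < p j" for i j
  proof -
    have "r i \<subseteq> r j" "j \<in> r j" "j \<notin> r i"
      using that by (auto simp: r_def)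
    then have "r i \<subset> r j" by blast
    then have "card (r i) < card (r j)"
      by (rule psubset_card_mono[rotated]) (simp add: r_def)
    then show ?thesis
      using that by (simp add: w_def)
  qed
  have inj: "inj_on w ?I"
  proof (rule inj_onI)
    fix i j assume ij: "i \<in> ?I" "j \<in> ?I" "w i = w j"
    then have "p i = p j"
      using mono[of i j] mono[of j i] by (cases "p i" "p j" rule: linorder_cases) auto
    then show "i = j"
      using inj_onD[OF assms(2)] ij by blast
  qed
  have "w i \<in> ?I" if i: "i \<in> ?I" for i
  proof -
    have "card {i} \<le> card (r i)"
      using i by (intro card_mono) (auto simp: r_def)
    moreover have "card (r i) \<le> card ?I"
      by (intro card_mono) (auto simp: r_def)
    ultimately show ?thesis using i by (simp add: w_def)
  qed
  then have "w ` ?I = ?I"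
    by (intro endo_inj_surj inj) auto
  then have "w permutes ?I"
    using inj by (intro bij_imp_permutes) (auto simp: bij_betw_def w_def)
  moreover have "p i < p j" if "i \<in> ?I" "j \<in> ?I" "w i < w j" for i j
  proof (rule ccontr)
    assume "\<not> p i < p j"
    then consider "p j < p i" | "p i = p j" by linarith
    then show False
    proof cases
      case 1
      then show ?thesis using mono[of j i] that by simp
    next
      case 2
      then have "i = j" using inj_onD[OF assms(2)] that by blast
      then show ?thesis using that by simp
    qed
  qed
  ultimately show ?thesis
    using assms(1) by (intro that) (auto simp: order_cell_def)
qed

text \<open>The coordinates are independent and identically distributed, so relabelling them by
  \<open>inv w\<close> preserves the measure, and this relabelling pulls the cell of
  \<open>id\<close> back to the cell of \<open>w\<close>.\<close>

lemma measure_order_cell_eq_id: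
  assumes w: "w permutes {1..n}"
  shows "measure (unifs {1..n}) (order_cell n w) = measure (unifs {1..n}) (order_cell n id)"
proof -
  let ?I = "{1..n}"
  let ?T = "\<lambda>p :: nat \<Rightarrow> real. \<lambda>k\<in>?I. p (inv w k)"
  have iw: "inv w permutes ?I"
    using w by (rule permutes_inv)
  have iwI: "inv w k \<in> ?I" if "k \<in> ?I" for k
    using that permutes_in_image[OF iw] by blast
  have T: "distr (unifs ?I) (unifs ?I) ?T = unifs ?I"
    by (rule distr_PiM_reindex[OF unif.prob_space_axioms permutes_inj_on[OF iw]]) (use iwI in blast)
  have [measurable]: "?T \<in> measurable (unifs ?I) (unifs ?I)"
    by (intro measurable_restrict measurable_component_singleton iwI)
  have "?T -` order_cell n id \<inter> space (unifs ?I) = order_cell n w"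
  proof -
    have "(\<forall>i\<in>?I. \<forall>j\<in>?I. i < j \<longrightarrow> p (inv w i) < p (inv w j)) \<longleftrightarrow>
          (\<forall>i\<in>?I. \<forall>j\<in>?I. w i < w j \<longrightarrow> p i < p j)" for p :: "nat \<Rightarrow> real"
      using permutes_in_image[OF w] permutes_in_image[OF iw] permutes_inverses[OF w] by metis
    moreover have "?T p \<in> space (unifs ?I)" for p
      by (simp add: space_PiM)
    ultimately show ?thesis
      by (auto simp: order_cell_def)
  qed
  then have "measure (distr (unifs ?I) (unifs ?I) ?T) (order_cell n id) = measure (unifs ?I) (order_cell n w)"
    by (subst measure_distr) auto
  then show ?thesis
    unfolding T by simp
qed

lemma measure_UN_order_cell:
  assumes "L \<subseteq> {w. w permutes {1..n}}"
  shows "measure (unifs {1..n}) (\<Union>w\<in>L. order_cell n w) =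
    card L * measure (unifs {1..n}) (order_cell n id)"
proof -
  have "finite L"
    using assms finite_permutations[of "{1..n}"] finite_subset by auto
  moreover have "order_cell n ` L \<subseteq> sets (unifs {1..n})"
    using sets_order_cell by blast
  moreover have "disjoint_family_on (order_cell n) L"
    unfolding disjoint_family_on_def using assms order_cell_disjoint by blast
  ultimately have "measure (unifs {1..n}) (\<Union>w\<in>L. order_cell n w) =
      (\<Sum>w\<in>L. measure (unifs {1..n}) (order_cell n w))"
    by (rule unifs.P.finite_measure_finite_Union)
  also have "\<dots> = (\<Sum>w\<in>L. measure (unifs {1..n}) (order_cell n id))"
    by (rule sum.cong) (use assms measure_order_cell_eq_id in blast)+
  finally show ?thesis by simp
qed

lemma AE_order_cell: "AE p in unifs {1..n}. \<exists>w. w permutes {1..n} \<and> p \<in> order_cell n w"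
proof -
  have "AE p in unifs {1..n}. \<forall>i\<in>{1..n}. \<forall>j\<in>{1..n}. i \<noteq> j \<longrightarrow> p i \<noteq> p j"
    by (intro AE_finite_allI) (auto intro!: AE_unifs_neq)
  with AE_space show ?thesis
  proof eventually_elim
    case (elim p)
    then have "inj_on p {1..n}" by (auto simp: inj_on_def)
    with elim show ?case using ex_order_cell by blast
  qed
qed

text \<open>The \<open>fact n\<close> disjoint cells have equal measure and together cover almost
  every point.\<close>

lemma measure_order_cell_id: "measure (unifs {1..n}) (order_cell n id) = 1 / fact n"
proof -
  let ?L = "{w. w permutes {1..n}}"
  have fin: "finite ?L" by (simp add: finite_permutations)
  have "card ?L * measure (unifs {1..n}) (order_cell n id) = measure (unifs {1..n}) (\<Union>w\<in>?L. order_cell n w)"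
    by (simp add: measure_UN_order_cell)
  also have "\<dots> = 1"
    using AE_order_cell[of n] fin by (subst unifs.P.prob_eq_1) auto
  finally show ?thesis
    by (simp add: card_permutations[of "{1..n}" n] field_simps)
qed

text \<open>Stanley's volume formula for order polytopes: up to a null set the polytope is the
  disjoint union of the cells of its linear extensions, and each cell has measure
  \<open>1 / fact n\<close>.\<close>

lemma measure_order_polytope:
  assumes "E \<subseteq> {1..n} \<times> {1..n}"
  shows "measure (unifs {1..n}) {p \<in> space (unifs {1..n}). \<forall>(i, j)\<in>E. p i \<le> p j} =
    card {w. w permutes {1..n} \<and> (\<forall>(i, j)\<in>E. w i \<le> w j)} / fact n"
proof -
  let ?M = "unifs {1..n}"
  let ?S = "{p \<in> space ?M. \<forall>(i, j)\<in>E. p i \<le> p j}"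
  let ?L = "{w. w permutes {1..n} \<and> (\<forall>(i, j)\<in>E. w i \<le> w j)}"
  have fin: "finite E" "finite ?L"
    using assms finite_subset finite_permutations[of "{1..n}"] by auto
  have "?S = {p \<in> space ?M. \<forall>e\<in>E. p (fst e) \<le> p (snd e)}"
    by (auto simp: case_prod_unfold)
  also have "\<dots> \<in> sets ?M"
    using fin assms by (intro sets.sets_Collect_finite_All borel_measurable_le) auto
  finally have S: "?S \<in> sets ?M" .
  have "measure ?M ?S = measure ?M (\<Union>w\<in>?L. order_cell n w)"
  proof (rule unifs.P.finite_measure_eq_AE[OF _ S])
    show "AE p in ?M. p \<in> ?S \<longleftrightarrow> p \<in> (\<Union>w\<in>?L. order_cell n w)"
      using AE_order_cell[of n]
    proof eventually_elim
      case (elim p)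
      then obtain w where w: "w permutes {1..n}" "p \<in> order_cell n w" by blast
      then have "p \<in> (\<Union>w\<in>?L. order_cell n w) \<longleftrightarrow> (\<forall>(i, j)\<in>E. w i \<le> w j)"
        using order_cell_disjoint by blast
      moreover have "(\<forall>(i, j)\<in>E. w i \<le> w j) \<longleftrightarrow> (\<forall>(i, j)\<in>E. p i \<le> p j)"
        using order_cell_le_iff[OF w] assms by blast
      moreover have "p \<in> space ?M"
        using w by (simp add: order_cell_def)
      ultimately show ?case by simp
    qed
  qed (use fin in auto)
  also have "\<dots> = card ?L * measure ?M (order_cell n id)"
    by (rule measure_UN_order_cell) auto
  finally show ?thesis
    by (simp add: measure_order_cell_id)
qed

subsection \<open>Cyclically alternating permutations\<close>

text \<open>
  The \<open>2 * m\<close> coordinates of the cycle are listed in cyclic order as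
  \<open>y\<^sub>m\<^sub>1, x\<^sub>1, y\<^sub>1\<^sub>2, x\<^sub>2, \<dots>, x\<^sub>m\<close>, so that odd positions carry the edges and even positions
  the vertices; both neighbours of an edge position are its endpoints.
\<close>

definition cyc_zigzag :: "nat \<Rightarrow> (nat \<Rightarrow> 'a :: ord) \<Rightarrow> bool" where
  "cyc_zigzag m w \<longleftrightarrow> (\<forall>n\<in>{1..2 * m}. odd n \<longrightarrow>
     w n \<le> w (n + 1) \<and> w n \<le> w (if n = 1 then 2 * m else n - 1))"

definition zigzag_perms :: "nat \<Rightarrow> (nat \<Rightarrow> nat) set" where
  "zigzag_perms m = {w. w permutes {1..2 * m} \<and> cyc_zigzag m w}"

section \<open>Rotations of the cycle and the position of the maximum\<close>

text \<open>A shift by two positions, because only even shifts take vertices to vertices and edges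
  to edges.\<close>

definition rot2 :: "nat \<Rightarrow> nat \<Rightarrow> nat" where
  "rot2 m i = (if i \<in> {1..2 * m} then if i \<le> 2 then i + 2 * m - 2 else i - 2 else i)"

lemma rot2_permutes: "rot2 m permutes {1..2 * m}"
proof (rule bij_imp_permutes)
  have inj: "inj_on (rot2 m) {1..2 * m}"
    by (rule inj_onI) (auto simp: rot2_def split: if_splits)
  moreover have "rot2 m ` {1..2 * m} \<subseteq> {1..2 * m}"
    by (auto simp: rot2_def; presburger)
  ultimately show "bij_betw (rot2 m) {1..2 * m} {1..2 * m}"
    by (simp add: bij_betw_def endo_inj_surj)
qed (auto simp: rot2_def)

text \<open>On odd positions the rotation commutes with passing to either cyclic neighbour, so each
  condition at \<open>n\<close> is the given one at \<open>rot2 m n\<close>.\<close>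

lemma cyc_zigzag_rot2:
  assumes "cyc_zigzag m w"
  shows "cyc_zigzag m (w \<circ> rot2 m)"
  unfolding cyc_zigzag_def
proof (intro ballI impI)
  fix n assume n: "n \<in> {1..2 * m}" "odd n"
  define k where "k = rot2 m n"
  \<comment> \<open>An odd position is never the last one, so its successor does not wrap
    around.\<close>
  have lt: "n < 2 * m"
    using n by (cases "n = 2 * m") auto
  have k: "k \<in> {1..2 * m}" "odd k"
    using n lt by (auto simp: k_def rot2_def)
  have "rot2 m (n + 1) = k + 1"
    using n lt by (cases "n = 2") (auto simp: k_def rot2_def)
  moreover have "rot2 m (if n = 1 then 2 * m else n - 1) = (if k = 1 then 2 * m else k - 1)"
  proof (cases "n = 1")
    case True
    then show ?thesis using lt by (auto simp: k_def rot2_def)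
  next
    case False
    then have "n \<ge> 3" using n by (cases "n = 2") auto
    then show ?thesis using n lt by (auto simp: k_def rot2_def)
  qed
  moreover have "w k \<le> w (k + 1) \<and> w k \<le> w (if k = 1 then 2 * m else k - 1)"
    using assms k unfolding cyc_zigzag_def by blast
  ultimately show "(w \<circ> rot2 m) n \<le> (w \<circ> rot2 m) (n + 1) \<and>
      (w \<circ> rot2 m) n \<le> (w \<circ> rot2 m) (if n = 1 then 2 * m else n - 1)"
    by (simp only: o_def k_def[symmetric])
qed

lemma odd_succ_le: "n \<le> 2 * m \<Longrightarrow> odd n \<Longrightarrow> n + 1 \<le> 2 * m" for n m :: nat
  by (cases "n = 2 * m") auto

lemma finite_zigzag_perms: "finite (zigzag_perms m)"
  unfolding zigzag_perms_def
  by (rule finite_subset[OF _ finite_permutations[of "{1..2 * m}"]]) auto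

text \<open>Composition with the rotation is injective on zigzags and carries the value at
  \<open>i\<close> to position \<open>j\<close>.\<close>

lemma card_zigzag_perms_top_le:
  assumes "rot2 m j = i"
  shows "card {w \<in> zigzag_perms m. w i = t} \<le> card {w \<in> zigzag_perms m. w j = t}"
proof (rule card_inj_on_le)
  let ?f = "\<lambda>w :: nat \<Rightarrow> nat. w \<circ> rot2 m"
  have surj: "surj (rot2 m)"
    using rot2_permutes by (rule permutes_surj)
  show "inj_on ?f {w \<in> zigzag_perms m. w i = t}"
  proof (rule inj_onI)
    fix v w :: "nat \<Rightarrow> nat" assume "v \<circ> rot2 m = w \<circ> rot2 m"
    then show "v = w" using surj by (metis comp_apply ext surjD)
  qed
  show "?f ` {w \<in> zigzag_perms m. w i = t} \<subseteq> {w \<in> zigzag_perms m. w j = t}"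
    using assms by (auto simp: zigzag_perms_def intro: permutes_compose[OF rot2_permutes] cyc_zigzag_rot2)
  show "finite {w \<in> zigzag_perms m. w j = t}"
    using finite_zigzag_perms by simp
qed

text \<open>Each rotation yields one inequality between counts at successive vertices. Going once
  round the cycle closes the chain, which forces equality.\<close>

lemma card_zigzag_perms_top_eq:
  assumes "k \<in> {1..m}"
  shows "card {w \<in> zigzag_perms m. w (2 * k) = t} = card {w \<in> zigzag_perms m. w (2 * m) = t}"
proof (rule antisym)
  let ?c = "\<lambda>k. card {w \<in> zigzag_perms m. w (2 * k) = t}"
  have le_Suc: "?c k \<le> ?c (Suc k)" if "1 \<le> k" "k < m" for k
    using that by (intro card_zigzag_perms_top_le) (auto simp: rot2_def)
  have "k \<le> m" "1 \<le> k" using assms by auto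
  then show "?c k \<le> ?c m"
  proof (induction rule: inc_induct)
    case (step n)
    then show ?case using le_Suc[of n] by simp
  qed simp
  have "?c m \<le> ?c 1"
    using assms by (intro card_zigzag_perms_top_le) (auto simp: rot2_def)
  also have "?c 1 \<le> ?c k"
    using \<open>1 \<le> k\<close> \<open>k \<le> m\<close>
  proof (induction rule: dec_induct)
    case (step n)
    then show ?case using le_Suc[of n] by simp
  qed simp
  finally show "?c m \<le> ?c k" .
qed

text \<open>At an odd position the maximum would be bounded by its successor, so two values would
  coincide, against injectivity.\<close>

lemma zigzag_perms_top_position:
  assumes "w \<in> zigzag_perms m" "m \<ge> 1"
  shows "\<exists>k\<in>{1..m}. w (2 * k) = 2 * m"
proof -
  have w: "w permutes {1..2 * m}" and z: "cyc_zigzag m w"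
    using assms(1) by (auto simp: zigzag_perms_def)
  have "2 * m \<in> w ` {1..2 * m}"
    using assms(2) by (simp add: permutes_image[OF w])
  then obtain n where n: "n \<in> {1..2 * m}" "w n = 2 * m"
    by auto
  have "even n"
  proof (rule ccontr)
    assume odd: "odd n"
    then have "n + 1 \<in> {1..2 * m}" using n by (cases "n = 2 * m") auto
    then have "w (n + 1) \<le> 2 * m" using permutes_in_seg[OF w] by blast
    moreover have "w n \<le> w (n + 1)" using z odd n unfolding cyc_zigzag_def by blast
    ultimately have "w (n + 1) = w n" using n(2) by linarith
    then show False by (simp add: inj_eq[OF permutes_inj[OF w]])
  qed
  then obtain k where "n = 2 * k" by blast
  then show ?thesis using n by (intro bexI[of _ k]) auto
qed

section \<open>Complementation and Euler numbers\<close>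

text \<open>Order reversal is required because \<open>euler_number\<close> starts with a descent,
  whereas a zigzag starts with an ascent from an edge position. Points outside the interval stay
  fixed so that \<open>flip N\<close> permutes it.\<close>

definition flip :: "nat \<Rightarrow> nat \<Rightarrow> nat" where
  "flip N i = (if i \<in> {1..N} then N + 1 - i else i)"

lemma flip_flip [simp]: "flip N (flip N i) = i"
  by (auto simp: flip_def)

lemma flip_permutes: "flip N permutes {1..N}"
  unfolding permutes_def
proof (intro conjI allI impI)
  show "\<exists>!x. flip N x = y" for y
    by (metis flip_flip)
qed (auto simp: flip_def)

text \<open>Such a \<open>w\<close> fixes \<open>2 * m\<close>, so the last vertex carries the
  maximum and its comparisons with both neighbours hold. The cycle thereby opens into a path on
  \<open>2 * m - 1\<close> positions; injectivity makes its inequalities strict and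
  \<open>flip\<close> reverses them.\<close>

lemma cyc_zigzag_iff_alternating:
  assumes w: "w permutes {1..2 * m - 1}" and m: "m \<ge> 1"
  shows "cyc_zigzag m w \<longleftrightarrow> (\<forall>i\<in>{1..<2 * m - 1}.
     if odd i then flip (2 * m - 1) (w i) > flip (2 * m - 1) (w (i + 1))
     else flip (2 * m - 1) (w i) < flip (2 * m - 1) (w (i + 1)))"
    (is "_ \<longleftrightarrow> (\<forall>i\<in>?I. ?P i)")
proof -
  have top: "w (2 * m) = 2 * m"
    using w m by (intro permutes_not_in[OF w]) auto
  have ran: "1 \<le> w i" "w i < 2 * m" if "i \<in> {1..2 * m - 1}" for i
    using permutes_in_seg[OF w that] m by auto
  have P: "?P i \<longleftrightarrow> (if odd i then w i \<le> w (i + 1) else w (i + 1) \<le> w i)" if "i \<in> ?I" for i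
  proof -
    have "w i \<noteq> w (i + 1)"
      by (simp add: inj_eq[OF permutes_inj[OF w]])
    moreover have "flip (2 * m - 1) (w i) = 2 * m - w i" "flip (2 * m - 1) (w (i + 1)) = 2 * m - w (i + 1)"
      using ran[of i] ran[of "i + 1"] that by (auto simp: flip_def)
    ultimately show ?thesis
      using ran[of i] ran[of "i + 1"] that by auto
  qed
  show ?thesis
  proof
    assume z: "cyc_zigzag m w"
    show "\<forall>i\<in>?I. ?P i"
    proof
      fix i assume i: "i \<in> ?I"
      have "w i \<le> w (i + 1)" if "odd i"
        using z that i by (auto simp: cyc_zigzag_def)
      \<comment> \<open>The zigzag conditions are attached to odd positions, so this one is the
        backward comparison at \<open>i + 1\<close>.\<close>
      moreover have "w (i + 1) \<le> w i" if "even i"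
        using z that i unfolding cyc_zigzag_def by (auto dest!: bspec[of _ _ "i + 1"])
      ultimately show "?P i"
        using P[OF i] by simp
    qed
  next
    assume a: "\<forall>i\<in>?I. ?P i"
    show "cyc_zigzag m w"
      unfolding cyc_zigzag_def
    proof (intro ballI impI)
      fix n assume n: "n \<in> {1..2 * m}" "odd n"
      have lt: "n \<in> {1..2 * m - 1}"
        using n by (cases "n = 2 * m") auto
      have "w n \<le> w (n + 1)"
      proof (cases "n = 2 * m - 1")
        case True
        then show ?thesis using ran[OF lt] top m by simp
      next
        case False
        then have "n \<in> ?I" using lt by auto
        then show ?thesis using a P n by metis
      qed
      moreover have "w n \<le> w (n - 1)" if "n \<noteq> 1"
      proof -
        have "n - 1 \<in> ?I" "even (n - 1)" "n - 1 + 1 = n"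
          using that lt n by auto
        then show ?thesis using a P by metis
      qed
      moreover have "w n \<le> w (2 * m)"
        using ran[OF lt] top by simp
      ultimately show "w n \<le> w (n + 1) \<and> w n \<le> w (if n = 1 then 2 * m else n - 1)"
        by (cases "n = 1") simp_all
    qed
  qed
qed

text \<open>Permutations of \<open>{1..2 * m}\<close> that fix the top element are permutations of
  \<open>{1..2 * m - 1}\<close>. On these, complementing the values is an involution that exchanges
  the two alternation patterns.\<close>

lemma card_zigzag_perms_top:
  assumes m: "m \<ge> 1"
  shows "card {w \<in> zigzag_perms m. w (2 * m) = 2 * m} = euler_number (2 * m - 1)"
proof -
  let ?N = "2 * m - 1"
  let ?A = "{w \<in> zigzag_perms m. w (2 * m) = 2 * m}"
  let ?B = "{w. w permutes {1..?N} \<and>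
     (\<forall>i\<in>{1..<?N}. if odd i then w i > w (i + 1) else w i < w (i + 1))}"
  have A: "?A = {w. w permutes {1..?N} \<and> cyc_zigzag m w}"
  proof (intro Collect_cong iffI; elim conjE)
    fix w assume "w \<in> zigzag_perms m" and top: "w (2 * m) = 2 * m"
    then have w: "w permutes {1..2 * m}" "cyc_zigzag m w"
      by (auto simp: zigzag_perms_def)
    have "w permutes {1..?N}"
    proof (rule permutes_superset[OF w(1)])
      fix x assume "x \<in> {1..2 * m} - {1..?N}"
      then have "x = 2 * m" by auto
      then show "w x = x" using top by simp
    qed
    with w show "w permutes {1..?N} \<and> cyc_zigzag m w" by simp
  next
    fix w assume w: "w permutes {1..?N}" "cyc_zigzag m w"
    have "w permutes {1..2 * m}"
      by (rule permutes_subset[OF w(1)]) auto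
    moreover have "w (2 * m) = 2 * m"
      using m by (intro permutes_not_in[OF w(1)]) auto
    ultimately show "w \<in> zigzag_perms m \<and> w (2 * m) = 2 * m"
      using w by (simp add: zigzag_perms_def)
  qed
  have "bij_betw (\<lambda>w. flip ?N \<circ> w) ?A ?B"
  proof (rule bij_betw_byWitness[where f' = "\<lambda>w. flip ?N \<circ> w"])
    show "(\<lambda>w. flip ?N \<circ> w) ` ?A \<subseteq> ?B"
      unfolding A using cyc_zigzag_iff_alternating[OF _ m]
      by (auto intro: permutes_compose[OF _ flip_permutes])
    show "(\<lambda>w. flip ?N \<circ> w) ` ?B \<subseteq> ?A"
      unfolding A
    proof (rule image_subsetI)
      fix w assume w: "w \<in> ?B"
      then have p: "flip ?N \<circ> w permutes {1..?N}"
        by (auto intro: permutes_compose[OF _ flip_permutes])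
      then show "flip ?N \<circ> w \<in> {w. w permutes {1..?N} \<and> cyc_zigzag m w}"
        using cyc_zigzag_iff_alternating[OF p m] w by simp
    qed
  qed (auto simp: fun_eq_iff)
  then show ?thesis
    unfolding euler_number_def by (rule bij_betw_same_card)
qed

text \<open>The zigzags are partitioned by the vertex that carries the maximum, and by rotation the
  \<open>m\<close> classes have equal size.\<close>

lemma card_zigzag_perms:
  assumes m: "m \<ge> 1"
  shows "card (zigzag_perms m) = m * euler_number (2 * m - 1)"
proof -
  let ?Z = "\<lambda>k. {w \<in> zigzag_perms m. w (2 * k) = 2 * m}"
  have "zigzag_perms m = (\<Union>k\<in>{1..m}. ?Z k)"
    using zigzag_perms_top_position[OF _ m] by blast
  moreover have "card (\<Union>k\<in>{1..m}. ?Z k) = (\<Sum>k\<in>{1..m}. card (?Z k))"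
  proof (rule card_UN_disjoint)
    show "\<forall>i\<in>{1..m}. \<forall>j\<in>{1..m}. i \<noteq> j \<longrightarrow> ?Z i \<inter> ?Z j = {}"
    proof (intro ballI impI equals0I)
      fix i j w assume "i \<noteq> j" "w \<in> ?Z i \<inter> ?Z j"
      then have "w permutes {1..2 * m}" "w (2 * i) = w (2 * j)"
        by (auto simp: zigzag_perms_def)
      then have "2 * i = 2 * j" using permutes_inj by (blast dest: injD)
      with \<open>i \<noteq> j\<close> show False by simp
    qed
  qed (use finite_zigzag_perms in auto)
  moreover have "(\<Sum>k\<in>{1..m}. card (?Z k)) = (\<Sum>k\<in>{1..m}. euler_number (2 * m - 1))"
    by (rule sum.cong) (simp_all only: card_zigzag_perms_top_eq card_zigzag_perms_top[OF m])
  ultimately show ?thesis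
    by simp
qed

lemma measure_cyc_zigzag:
  assumes m: "m \<ge> 1"
  shows "measure (unifs {1..2 * m}) {p \<in> space (unifs {1..2 * m}). cyc_zigzag m p} =
    m * euler_number (2 * m - 1) / fact (2 * m)"
proof -
  let ?K = "{1..2 * m}"
  \<comment> \<open>The relations of the cyclic zigzag poset: each edge position lies below both of
    its neighbours.\<close>
  define E where "E = (\<lambda>n. (n, n + 1)) ` {n \<in> ?K. odd n} \<union>
    (\<lambda>n. (n, if n = 1 then 2 * m else n - 1)) ` {n \<in> ?K. odd n}"
  have sub: "E \<subseteq> ?K \<times> ?K"
  proof -
    have "n + 1 \<in> ?K" if "n \<in> ?K" "odd n" for n
      using that by (auto intro: odd_succ_le)
    then show ?thesis
      by (auto simp: E_def)
  qed
  \<comment> \<open>Kept polymorphic in the values, since it serves both for real points and for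
    permutations.\<close>
  have E: "(\<forall>(i, j)\<in>E. w i \<le> w j) \<longleftrightarrow> cyc_zigzag m w" for w :: "nat \<Rightarrow> 'b :: ord"
    unfolding E_def cyc_zigzag_def ball_Un Set.ball_simps(9) prod.case by blast
  show ?thesis
    using measure_order_polytope[OF sub] card_zigzag_perms[OF m]
    by (simp add: E zigzag_perms_def)
qed

subsection \<open>The tent map\<close>

text \<open>Equal to \<open>2 * min x (1 - x)\<close>.\<close>

definition tent :: "real \<Rightarrow> real" where
  "tent x = 1 - \<bar>2 * x - 1\<bar>"

lemma tent_measurable [measurable]: "tent \<in> borel_measurable borel"
  unfolding tent_def by measurable

lemma tent_measurable_unif: "tent \<in> measurable unif unif"
  unfolding measurable_cong_sets[OF sets_unif sets_unif] by (rule tent_measurable)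

lemma emeasure_unif_atMost: "emeasure unif {..c} = ennreal (max 0 (min 1 c))"
proof -
  have "{0..1} \<inter> {..c} = {0..min 1 c}"
    by auto
  then show ?thesis
    by (cases "c \<ge> 0") (auto simp: emeasure_unif max_def)
qed

text \<open>For \<open>0 \<le> c < 1\<close> the preimage meets the unit interval in two disjoint
  end intervals of length \<open>c / 2\<close>, of total length \<open>c\<close>. Hence the tent map
  preserves the uniform distribution function.\<close>

lemma emeasure_unif_tent_vimage: "emeasure unif (tent -` {..c}) = ennreal (max 0 (min 1 c))"
proof -
  have meas: "tent -` {..c} \<in> sets borel"
    using measurable_sets[OF tent_measurable, of "{..c}"] by simp
  consider "c < 0" | "0 \<le> c" "c < 1" | "c \<ge> 1" by linarith
  then show ?thesis
  proof cases
    case 1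
    then have "{0..1} \<inter> tent -` {..c} = {}"
      by (auto simp: tent_def abs_if split: if_splits)
    with 1 show ?thesis by (simp add: emeasure_unif meas)
  next
    case 2
    then have "{0..1} \<inter> tent -` {..c} = {0..c / 2} \<union> {1 - c / 2..1}"
      by (auto simp: tent_def abs_if split: if_splits)
    moreover have "emeasure lborel ({0..c / 2} \<union> {1 - c / 2..1}) =
        emeasure lborel {0..c / 2} + emeasure lborel {1 - c / 2..1}"
      using 2 by (intro plus_emeasure[symmetric]) auto
    ultimately show ?thesis
      using 2 by (simp add: emeasure_unif meas flip: ennreal_plus)
  next
    case 3
    then have "{0..1} \<inter> tent -` {..c} = {0..1}"
      by (auto simp: tent_def abs_if)
    with 3 show ?thesis by (simp add: emeasure_unif meas)
  qed
qed

lemma distr_unif_tent: "distr unif unif tent = unif"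
proof (rule cdf_unique)
  show "real_distribution unif"
    by unfold_locales simp_all
  show "real_distribution (distr unif unif tent)"
    using unif.prob_space_distr[OF tent_measurable_unif]
    by (simp add: real_distribution_def real_distribution_axioms_def)
  have "measure (distr unif unif tent) {..c} = measure unif {..c}" for c
    using measure_distr[OF tent_measurable_unif, of "{..c}"]
    by (simp add: measure_def[of unif] emeasure_unif_tent_vimage emeasure_unif_atMost)
  then show "cdf (distr unif unif tent) = cdf unif"
    by (simp add: cdf_def fun_eq_iff)
qed

text \<open>The length of the fibre is the minimum of \<open>s\<close>, \<open>t\<close>,
  \<open>1 - s\<close> and \<open>1 - t\<close>, which is half the smaller tent value. The
  truncation to the unit interval changes nothing here and matches the form in
  \<open>emeasure_unif_atMost\<close>.\<close>

lemma emeasure_unif_hypersimplex_fibre: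
  assumes "s \<in> {0..1}" "t \<in> {0..1}"
  shows "emeasure unif {s + t - 1..min s t} =
    ennreal (1 / 2) * ennreal (max 0 (min 1 (min (tent s) (tent t))))"
proof -
  have le: "max 0 (s + t - 1) \<le> min s t"
    using assms by auto
  have "emeasure unif {s + t - 1..min s t} = emeasure lborel ({0..1} \<inter> {s + t - 1..min s t})"
    by (rule emeasure_unif) simp
  also have "{0..1} \<inter> {s + t - 1..min s t} = {max 0 (s + t - 1)..min s t}"
    using assms by auto
  also have "emeasure lborel {max 0 (s + t - 1)..min s t} = ennreal (min s t - max 0 (s + t - 1))"
    using le by (rule emeasure_lborel_Icc)
  also have "min s t - max 0 (s + t - 1) = 1 / 2 * max 0 (min 1 (min (tent s) (tent t)))"
    using assms by (cases "s \<le> t"; cases "s + t \<le> 1") (auto simp: tent_def abs_if min_def max_def)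
  finally show ?thesis
    by (subst ennreal_mult[symmetric]) simp_all
qed

section \<open>Integrating out the edge coordinates\<close>

text \<open>Fubini: over each fixed \<open>x\<close> the fibre of \<open>S\<close> is a box, whose
  measure is the product of the measures of its sides.\<close>

lemma emeasure_unifs_fibre_boxes:
  assumes "I \<inter> J = {}" "finite I" "finite J" "S \<in> sets (unifs (I \<union> J))"
    and B: "\<And>x n. B x n \<in> sets borel"
    and S: "\<And>x y. x \<in> space (unifs I) \<Longrightarrow> y \<in> space (unifs J) \<Longrightarrow>
      merge I J (x, y) \<in> S \<longleftrightarrow> (\<forall>n\<in>J. y n \<in> B x n)"
  shows "emeasure (unifs (I \<union> J)) S = (\<integral>\<^sup>+ x. (\<Prod>n\<in>J. emeasure unif (B x n)) \<partial>unifs I)"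
  unfolding unifs.emeasure_fold_integral[OF assms(1-4)]
proof (rule nn_integral_cong)
  fix x assume x: "x \<in> space (unifs I)"
  have "(\<lambda>y. merge I J (x, y)) -` S \<inter> space (unifs J) = Pi\<^sub>E J (B x)"
    using S[OF x] by (auto simp: space_PiM PiE_iff)
  then show "emeasure (unifs J) ((\<lambda>y. merge I J (x, y)) -` S \<inter> space (unifs J)) =
      (\<Prod>n\<in>J. emeasure unif (B x n))"
    using B by (simp add: unifs.emeasure_PiM assms(3))
qed

text \<open>The form of \<open>Q_polytope\<close> along the cyclic listing of coordinates; the
  bounds 0 and 1 are carried by the measure.\<close>

definition cyc_stable :: "nat \<Rightarrow> (nat \<Rightarrow> real) \<Rightarrow> bool" where
  "cyc_stable m p \<longleftrightarrow> cyc_zigzag m p \<and> (\<forall>n\<in>{1..2 * m}. odd n \<longrightarrow>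
     p (n + 1) + p (if n = 1 then 2 * m else n - 1) \<le> 1 + p n)"

lemma sets_cyc_zigzag: "{p \<in> space (unifs {1..2 * m}). cyc_zigzag m p} \<in> sets (unifs {1..2 * m})"
proof -
  have "cyc_zigzag m p \<longleftrightarrow> (\<forall>n\<in>{n \<in> {1..2 * m}. odd n}.
      p n \<le> p (n + 1) \<and> p n \<le> p (if n = 1 then 2 * m else n - 1))" for p :: "nat \<Rightarrow> real"
    by (auto simp: cyc_zigzag_def)
  then show ?thesis
    by (simp only:, intro sets.sets_Collect_finite_All sets.sets_Collect_conj borel_measurable_le
        measurable_unifs_component) (auto intro: odd_succ_le)
qed

lemma sets_cyc_stable: "{p \<in> space (unifs {1..2 * m}). cyc_stable m p} \<in> sets (unifs {1..2 * m})"
proof -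
  have "cyc_stable m p \<longleftrightarrow> cyc_zigzag m p \<and> (\<forall>n\<in>{n \<in> {1..2 * m}. odd n}.
      p (n + 1) + p (if n = 1 then 2 * m else n - 1) \<le> 1 + p n)" for p :: "nat \<Rightarrow> real"
    by (auto simp: cyc_stable_def)
  then show ?thesis
    by (simp only:, intro sets.sets_Collect_conj sets_cyc_zigzag sets.sets_Collect_finite_All
        borel_measurable_le borel_measurable_add borel_measurable_const measurable_unifs_component)
      (auto intro: odd_succ_le)
qed

text \<open>Integrating over the edges turns both measures into integrals over the vertices. If
  \<open>F\<close> is the integrand for \<open>cyc_zigzag\<close>, the one for
  \<open>cyc_stable\<close> is almost everywhere \<open>(1 / 2) ^ m\<close> times \<open>F\<close>
  after the tent map on every vertex, and the tent map preserves the measure.\<close>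

lemma measure_cyc_stable:
  "measure (unifs {1..2 * m}) {p \<in> space (unifs {1..2 * m}). cyc_stable m p} =
   measure (unifs {1..2 * m}) {p \<in> space (unifs {1..2 * m}). cyc_zigzag m p} / 2 ^ m"
proof -
  define I where "I = {n \<in> {1..2 * m}. even n}"
  define J where "J = {n \<in> {1..2 * m}. odd n}"
  define prv where "prv n = (if n = 1 then 2 * m else n - 1)" for n
  define F where "F x = (\<Prod>n\<in>J. ennreal (max 0 (min 1 (min (x (n + 1)) (x (prv n))))))"
    for x :: "nat \<Rightarrow> real"
  have IJ: "I \<inter> J = {}" "finite I" "finite J" "{1..2 * m} = I \<union> J"
    by (auto simp: I_def J_def)
  \<comment> \<open>Both neighbours of an edge position are vertices. Hence, for fixed vertex
    coordinates, the conditions on distinct edges are independent and the fibres are boxes.\<close>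
  have nb: "n + 1 \<in> I" "prv n \<in> I" if "n \<in> J" for n
    using that by (auto intro: odd_succ_le simp: I_def J_def prv_def)
  have card_J: "card J = m"
  proof -
    have "bij_betw (\<lambda>k. 2 * k - 1) {1..m} J"
      by (rule bij_betw_byWitness[where f' = "\<lambda>n. (n + 1) div 2"]) (auto simp: J_def elim!: oddE)
    then show ?thesis
      using bij_betw_same_card by fastforce
  qed
  have zigzag: "cyc_zigzag m p \<longleftrightarrow> (\<forall>n\<in>J. p n \<in> {..min (p (n + 1)) (p (prv n))})" for p :: "nat \<Rightarrow> real"
    unfolding cyc_zigzag_def J_def prv_def by auto
  have stable: "cyc_stable m p \<longleftrightarrow> (\<forall>n\<in>J. p n \<in> {p (n + 1) + p (prv n) - 1..min (p (n + 1)) (p (prv n))})"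
    for p :: "nat \<Rightarrow> real"
    unfolding cyc_stable_def cyc_zigzag_def J_def prv_def by (auto simp: algebra_simps)
  have merge: "merge I J (x, y) n = y n" "merge I J (x, y) (n + 1) = x (n + 1)"
    "merge I J (x, y) (prv n) = x (prv n)"
    if "n \<in> J" for x y :: "nat \<Rightarrow> real" and n
    using that nb[OF that] IJ by (auto simp: merge_def)
  have space: "merge I J (x, y) \<in> space (unifs (I \<union> J))" for x y :: "nat \<Rightarrow> real"
    by (simp add: space_PiM PiE_def extensional_def merge_def)
  have compose: "compose I tent \<in> measurable (unifs I) (unifs I)"
    unfolding compose_def
    by (intro measurable_restrict measurable_component_singleton
        measurable_compose[OF _ tent_measurable_unif])
  have F: "F \<in> borel_measurable (unifs I)"
    unfolding F_def using nb by measurable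
  have "emeasure (unifs (I \<union> J)) {p \<in> space (unifs (I \<union> J)). cyc_zigzag m p} =
      (\<integral>\<^sup>+ x. (\<Prod>n\<in>J. emeasure unif {..min (x (n + 1)) (x (prv n))}) \<partial>unifs I)"
  proof (rule emeasure_unifs_fibre_boxes[OF IJ(1-3)])
    show "merge I J (x, y) \<in> {p \<in> space (unifs (I \<union> J)). cyc_zigzag m p} \<longleftrightarrow>
        (\<forall>n\<in>J. y n \<in> {..min (x (n + 1)) (x (prv n))})" for x y
      unfolding zigzag using space[of x y] by (simp add: merge)
  qed (use sets_cyc_zigzag[of m] in \<open>auto simp: IJ\<close>)
  then have Z: "emeasure (unifs (I \<union> J)) {p \<in> space (unifs (I \<union> J)). cyc_zigzag m p} =
      (\<integral>\<^sup>+ x. F x \<partial>unifs I)"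
    by (simp add: emeasure_unif_atMost F_def)
  have "emeasure (unifs (I \<union> J)) {p \<in> space (unifs (I \<union> J)). cyc_stable m p} =
      (\<integral>\<^sup>+ x. (\<Prod>n\<in>J. emeasure unif {x (n + 1) + x (prv n) - 1..min (x (n + 1)) (x (prv n))}) \<partial>unifs I)"
  proof (rule emeasure_unifs_fibre_boxes[OF IJ(1-3)])
    show "merge I J (x, y) \<in> {p \<in> space (unifs (I \<union> J)). cyc_stable m p} \<longleftrightarrow>
        (\<forall>n\<in>J. y n \<in> {x (n + 1) + x (prv n) - 1..min (x (n + 1)) (x (prv n))})" for x y
      unfolding stable using space[of x y] by (simp add: merge)
  qed (use sets_cyc_stable[of m] in \<open>auto simp: IJ\<close>)
  also have "\<dots> = (\<integral>\<^sup>+ x. ennreal (1 / 2) ^ m * F (compose I tent x) \<partial>unifs I)"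
    \<comment> \<open>The half-tent formula for fibre lengths is available for vertex coordinates in
      the unit interval, which is almost everywhere.\<close>
    using AE_unifs_cube[OF IJ(2)]
  proof (intro nn_integral_cong_AE, eventually_elim)
    case (elim x)
    have "emeasure unif {x (n + 1) + x (prv n) - 1..min (x (n + 1)) (x (prv n))} =
        ennreal (1 / 2) * ennreal (max 0 (min 1 (min (compose I tent x (n + 1)) (compose I tent x (prv n)))))"
      if "n \<in> J" for n
      using emeasure_unif_hypersimplex_fibre[of "x (n + 1)" "x (prv n)"] nb[OF that] elim
      by (simp add: PiE_iff compose_def)
    then show ?case
      by (simp add: F_def prod.distrib card_J)
  qed
  also have "\<dots> = ennreal (1 / 2) ^ m * (\<integral>\<^sup>+ x. F (compose I tent x) \<partial>unifs I)"
    by (rule nn_integral_cmult[OF measurable_compose[OF compose F]])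
  also have "(\<integral>\<^sup>+ x. F (compose I tent x) \<partial>unifs I) = (\<integral>\<^sup>+ x. F x \<partial>unifs I)"
  proof -
    have "distr (unifs I) (unifs I) (compose I tent) = (\<Pi>\<^sub>M i\<in>I. distr unif unif tent)"
      by (rule distr_PiM_finite_prob_space'[OF IJ(2) unif.prob_space_axioms unif.prob_space_axioms
            tent_measurable_unif])
    then have "distr (unifs I) (unifs I) (compose I tent) = unifs I"
      by (simp only: distr_unif_tent)
    then have "(\<integral>\<^sup>+ x. F x \<partial>unifs I) = (\<integral>\<^sup>+ x. F x \<partial>distr (unifs I) (unifs I) (compose I tent))"
      by simp
    also have "\<dots> = (\<integral>\<^sup>+ x. F (compose I tent x) \<partial>unifs I)"
      by (rule nn_integral_distr[OF compose]) (simp only: measurable_distr_eq1 F)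
    finally show ?thesis ..
  qed
  also note Z[symmetric]
  also have "ennreal (1 / 2) ^ m = ennreal ((1 / 2) ^ m)"
    by (rule ennreal_power) simp
  finally show ?thesis
    unfolding IJ(4) measure_def by (simp add: enn2real_mult power_divide)
qed

subsection \<open>Coordinates of the cycle graph\<close>

text \<open>The edge at odd \<open>n\<close> joins the vertices at positions \<open>n + 1\<close>
  and \<open>n - 1\<close>; at \<open>n = 1\<close> position \<open>2 * m\<close> stands in for 0,
  which gives the closing edge of the cycle.\<close>

definition coord_of :: "nat \<Rightarrow> nat \<Rightarrow> nat + nat set" where
  "coord_of m n = (if even n then Inl (n div 2)
     else Inr {(n + 1) div 2, (if n = 1 then 2 * m else n - 1) div 2})"

lemma mem_edges_cycle_graph_iff:
  assumes "m \<ge> 1"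
  shows "e \<in> snd (cycle_graph m) \<longleftrightarrow>
    (\<exists>n\<in>{1..2 * m}. odd n \<and> e = {(n + 1) div 2, (if n = 1 then 2 * m else n - 1) div 2})"
    (is "_ \<longleftrightarrow> ?R")
proof
  assume "e \<in> snd (cycle_graph m)"
  then consider i where "i \<in> {1..<m}" "e = {i, i + 1}" | "e = {m, 1}"
    by (auto simp: cycle_graph_def)
  then show ?R
  proof cases
    case 1
    \<comment> \<open>This edge sits between the vertex positions \<open>2 * i\<close> and
      \<open>2 * i + 2\<close>.\<close>
    then show ?thesis by (intro bexI[of _ "2 * i + 1"]) auto
  next
    case 2
    then show ?thesis using assms by (intro bexI[of _ 1]) auto
  qed
next
  assume ?R
  then obtain n where n: "n \<in> {1..2 * m}" "odd n"
    and e: "e = {(n + 1) div 2, (if n = 1 then 2 * m else n - 1) div 2}"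
    by blast
  from n(2) obtain i where i: "n = 2 * i + 1" by (elim oddE)
  show "e \<in> snd (cycle_graph m)"
  proof (cases "i = 0")
    case True
    then show ?thesis using e i by (auto simp: cycle_graph_def)
  next
    case False
    then have "e = {i, i + 1}" "i \<in> {1..<m}" using e i n by auto
    then show ?thesis by (auto simp: cycle_graph_def)
  qed
qed

text \<open>A pair \<open>{i, j}\<close> arises from both orders of its ends, while a position fixes
  one order; symmetry of \<open>P\<close> bridges the difference.\<close>

lemma all_edges_cycle_graph_iff:
  assumes "m \<ge> 1" "\<And>i j. P i j \<longleftrightarrow> P j i"
  shows "(\<forall>i j. {i, j} \<in> snd (cycle_graph m) \<longrightarrow> P i j) \<longleftrightarrow>
    (\<forall>n\<in>{1..2 * m}. odd n \<longrightarrow> P ((n + 1) div 2) ((if n = 1 then 2 * m else n - 1) div 2))"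
  (is "?L \<longleftrightarrow> ?R")
proof
  assume ?L
  then show ?R
    using mem_edges_cycle_graph_iff[OF assms(1)] by blast
next
  assume R: ?R
  show ?L
  proof (intro allI impI)
    fix i j assume "{i, j} \<in> snd (cycle_graph m)"
    then obtain n where "n \<in> {1..2 * m}" "odd n"
      "{i, j} = {(n + 1) div 2, (if n = 1 then 2 * m else n - 1) div 2}"
      using mem_edges_cycle_graph_iff[OF assms(1)] by blast
    then show "P i j"
      using R assms(2) unfolding doubleton_eq_iff by blast
  qed
qed

lemma coord_of_image:
  assumes "m \<ge> 1"
  shows "coord_of m ` {1..2 * m} = coords (cycle_graph m)"
proof
  show "coord_of m ` {1..2 * m} \<subseteq> coords (cycle_graph m)"
  proof (rule image_subsetI)
    fix n assume n: "n \<in> {1..2 * m}"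
    show "coord_of m n \<in> coords (cycle_graph m)"
    proof (cases "even n")
      case True
      then show ?thesis
        using n by (auto simp: coord_of_def coords_def cycle_graph_def)
    next
      case False
      then have "{(n + 1) div 2, (if n = 1 then 2 * m else n - 1) div 2} \<in> snd (cycle_graph m)"
        using n mem_edges_cycle_graph_iff[OF assms] by blast
      then show ?thesis
        using False by (simp only: coord_of_def coords_def if_False InrI)
    qed
  qed
  show "coords (cycle_graph m) \<subseteq> coord_of m ` {1..2 * m}"
  proof
    fix c assume "c \<in> coords (cycle_graph m)"
    then consider i where "i \<in> {1..m}" "c = Inl i" | e where "e \<in> snd (cycle_graph m)" "c = Inr e"
      by (auto simp: coords_def cycle_graph_def)
    then show "c \<in> coord_of m ` {1..2 * m}"
    proof cases
      case 1
      then show ?thesis by (intro image_eqI[of _ _ "2 * i"]) (auto simp: coord_of_def)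
    next
      case 2
      then obtain n where "n \<in> {1..2 * m}" "odd n" "c = coord_of m n"
        using mem_edges_cycle_graph_iff[OF assms, of e] unfolding coord_of_def by auto
      then show ?thesis by blast
    qed
  qed
qed

text \<open>Reindexing coordinates along the bijection \<open>coord_of\<close> preserves the uniform
  product measure, so conditions on the graph may be replaced by conditions on cyclic
  positions.\<close>

lemma graph_vol_cycle_graph:
  fixes \<phi> :: "(nat + nat set \<Rightarrow> real) \<Rightarrow> bool" and \<psi> :: "(nat \<Rightarrow> real) \<Rightarrow> bool"
  assumes m: "m \<ge> 3"
    and meas: "{p \<in> space (unifs {1..2 * m}). \<psi> p} \<in> sets (unifs {1..2 * m})"
    and eq: "\<And>q. q \<in> coords (cycle_graph m) \<rightarrow>\<^sub>E {0..1} \<Longrightarrow>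
      \<phi> q \<longleftrightarrow> \<psi> (\<lambda>n\<in>{1..2 * m}. q (coord_of m n))"
  shows "graph_vol (cycle_graph m) {q \<in> coords (cycle_graph m) \<rightarrow>\<^sub>E {0..1}. \<phi> q} =
    measure (unifs {1..2 * m}) {p \<in> space (unifs {1..2 * m}). \<psi> p}"
proof -
  let ?K = "{1..2 * m}" and ?C = "coords (cycle_graph m)"
  let ?S = "{p \<in> space (unifs ?K). \<psi> p}"
  let ?T = "\<lambda>q :: nat + nat set \<Rightarrow> real. \<lambda>n\<in>?K. q (coord_of m n)"
  have im: "coord_of m ` ?K = ?C"
    using m by (intro coord_of_image) simp
  have fin: "finite ?C"
    unfolding im[symmetric] by simp
  \<comment> \<open>A surjection between sets of the same finite size is injective. The count uses
    \<open>m \<ge> 3\<close>: for \<open>m = 2\<close> the two edges would coincide.\<close>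
  have inj: "inj_on (coord_of m) ?K"
    by (rule eq_card_imp_inj_on) (simp_all add: im card_coords_cycle_graph[OF m])
  have T: "distr (unifs ?C) (unifs ?K) ?T = unifs ?K"
    by (rule distr_PiM_reindex[OF unif.prob_space_axioms inj]) (use im in blast)
  have T_meas: "?T \<in> measurable (unifs ?C) (unifs ?K)"
    by (intro measurable_restrict measurable_component_singleton) (use im in blast)
  have "{q \<in> ?C \<rightarrow>\<^sub>E {0..1}. \<phi> q} = (?C \<rightarrow>\<^sub>E {0..1}) \<inter> (?T -` ?S \<inter> space (unifs ?C))"
    using eq by (auto simp: space_PiM)
  then have "graph_vol (cycle_graph m) {q \<in> ?C \<rightarrow>\<^sub>E {0..1}. \<phi> q} =
      measure (unifs ?C) (?T -` ?S \<inter> space (unifs ?C))"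
    using measure_lborel_cube_Int[OF fin measurable_sets[OF T_meas meas]] by (simp add: graph_vol_def)
  also have "\<dots> = measure (distr (unifs ?C) (unifs ?K) ?T) ?S"
    by (rule measure_distr[OF T_meas meas, symmetric])
  finally show ?thesis
    unfolding T .
qed

section \<open>The two polytopes in cyclic coordinates\<close>

lemma cyc_zigzag_restrict_iff:
  fixes q :: "nat + nat set \<Rightarrow> real"
  assumes "m \<ge> 1"
  shows "cyc_zigzag m (\<lambda>n\<in>{1..2 * m}. q (coord_of m n)) \<longleftrightarrow>
    (\<forall>i j. {i, j} \<in> snd (cycle_graph m) \<longrightarrow> q (Inr {i, j}) \<le> q (Inl i) \<and> q (Inr {i, j}) \<le> q (Inl j))"
proof -
  have "(\<forall>i j. {i, j} \<in> snd (cycle_graph m) \<longrightarrow> q (Inr {i, j}) \<le> q (Inl i) \<and> q (Inr {i, j}) \<le> q (Inl j)) \<longleftrightarrow>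
    (\<forall>n\<in>{1..2 * m}. odd n \<longrightarrow> (\<lambda>i j. q (Inr {i, j}) \<le> q (Inl i) \<and> q (Inr {i, j}) \<le> q (Inl j))
       ((n + 1) div 2) ((if n = 1 then 2 * m else n - 1) div 2))"
    using assms by (intro all_edges_cycle_graph_iff) (auto simp: insert_commute)
  also have "\<dots> \<longleftrightarrow> cyc_zigzag m (\<lambda>n\<in>{1..2 * m}. q (coord_of m n))"
    unfolding cyc_zigzag_def
  proof (intro ball_cong refl imp_cong)
    fix n assume n: "n \<in> {1..2 * m}" "odd n"
    show "(\<lambda>i j. q (Inr {i, j}) \<le> q (Inl i) \<and> q (Inr {i, j}) \<le> q (Inl j))
       ((n + 1) div 2) ((if n = 1 then 2 * m else n - 1) div 2) \<longleftrightarrow>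
       (\<lambda>n\<in>{1..2 * m}. q (coord_of m n)) n \<le> (\<lambda>n\<in>{1..2 * m}. q (coord_of m n)) (n + 1) \<and>
       (\<lambda>n\<in>{1..2 * m}. q (coord_of m n)) n \<le> (\<lambda>n\<in>{1..2 * m}. q (coord_of m n)) (if n = 1 then 2 * m else n - 1)"
      using n odd_succ_le[of n m] by (auto simp: coord_of_def)
  qed
  finally show ?thesis ..
qed

lemma cyc_stable_restrict_iff:
  assumes "m \<ge> 1" "q \<in> coords (cycle_graph m) \<rightarrow>\<^sub>E {0..1::real}"
  shows "cyc_stable m (\<lambda>n\<in>{1..2 * m}. q (coord_of m n)) \<longleftrightarrow>
    (\<forall>i j. {i, j} \<in> snd (cycle_graph m) \<longrightarrow> 0 \<le> q (Inr {i, j}) \<and> q (Inr {i, j}) \<le> q (Inl i) \<and>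
       q (Inr {i, j}) \<le> q (Inl j) \<and> q (Inl i) + q (Inl j) \<le> 1 + q (Inr {i, j}))"
proof -
  \<comment> \<open>\<open>cyc_stable\<close> leaves nonnegativity of the edge coordinates to the
    cube, which supplies it here.\<close>
  have nonneg: "0 \<le> q (Inr {i, j})" if "{i, j} \<in> snd (cycle_graph m)" for i j
    using that assms(2) by (auto simp: coords_def PiE_iff)
  have "(\<forall>i j. {i, j} \<in> snd (cycle_graph m) \<longrightarrow> q (Inl i) + q (Inl j) \<le> 1 + q (Inr {i, j})) \<longleftrightarrow>
    (\<forall>n\<in>{1..2 * m}. odd n \<longrightarrow> (\<lambda>i j. q (Inl i) + q (Inl j) \<le> 1 + q (Inr {i, j}))
       ((n + 1) div 2) ((if n = 1 then 2 * m else n - 1) div 2))"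
    using assms by (intro all_edges_cycle_graph_iff) (auto simp: insert_commute add.commute)
  also have "\<dots> \<longleftrightarrow> (\<forall>n\<in>{1..2 * m}. odd n \<longrightarrow>
       (\<lambda>n\<in>{1..2 * m}. q (coord_of m n)) (n + 1) +
       (\<lambda>n\<in>{1..2 * m}. q (coord_of m n)) (if n = 1 then 2 * m else n - 1)
       \<le> 1 + (\<lambda>n\<in>{1..2 * m}. q (coord_of m n)) n)"
  proof (intro ball_cong refl imp_cong)
    fix n assume n: "n \<in> {1..2 * m}" "odd n"
    show "(\<lambda>i j. q (Inl i) + q (Inl j) \<le> 1 + q (Inr {i, j}))
       ((n + 1) div 2) ((if n = 1 then 2 * m else n - 1) div 2) \<longleftrightarrow>
       (\<lambda>n\<in>{1..2 * m}. q (coord_of m n)) (n + 1) +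
       (\<lambda>n\<in>{1..2 * m}. q (coord_of m n)) (if n = 1 then 2 * m else n - 1)
       \<le> 1 + (\<lambda>n\<in>{1..2 * m}. q (coord_of m n)) n"
      using n odd_succ_le[of n m] by (auto simp: coord_of_def)
  qed
  finally show ?thesis
    unfolding cyc_stable_def cyc_zigzag_restrict_iff[OF assms(1)] using nonneg by blast
qed

theorem theorem13:
  fixes m :: nat
  assumes "m \<ge> 3"
  shows "graph_vol (cycle_graph m) (Q_polytope (cycle_graph m)) =
           graph_vol (cycle_graph m) (O_polytope (cycle_graph m)) / 2 ^ m \<and>
         graph_vol (cycle_graph m) (O_polytope (cycle_graph m)) / 2 ^ m =
           real m * real (euler_number (2 * m - 1)) / (2 ^ m * fact (2 * m))"
proof -
  have m: "m \<ge> 1" using assms by simp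
  have O: "graph_vol (cycle_graph m) (O_polytope (cycle_graph m)) =
      measure (unifs {1..2 * m}) {p \<in> space (unifs {1..2 * m}). cyc_zigzag m p}"
    unfolding O_polytope_def
    by (rule graph_vol_cycle_graph[OF assms sets_cyc_zigzag]) (simp only: cyc_zigzag_restrict_iff[OF m])
  have Q: "graph_vol (cycle_graph m) (Q_polytope (cycle_graph m)) =
      measure (unifs {1..2 * m}) {p \<in> space (unifs {1..2 * m}). cyc_stable m p}"
    unfolding Q_polytope_def
    by (rule graph_vol_cycle_graph[OF assms sets_cyc_stable]) (simp only: cyc_stable_restrict_iff[OF m])
  show ?thesis
    unfolding O Q measure_cyc_stable measure_cyc_zigzag[OF m] by (simp add: mult.commute)
qed

end
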